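(* Let $(\Omega,\mathcal{F},\mathbb{P})$ be a probability space, let $Y\in\mathcal{L}^2$ be a real-valued random variable on it with $\mu_0:=\mathbb{E}(Y)$, let $X_1,\dots,X_N$ be calibrated predictions of $Y$, and let $\mathcal{X}'':=\mathbb{E}(Y\mid X_1,\dots,X_N)$. Let $\mathcal{X}_w=\sum_{j=1}^N w_jX_j$ be a non-trivial arithmetic mean. Then the following holds. (i) $\mathcal{X}_w$ is marginally consistent: $\mathbb{E}(\mathcal{X}_w)=\mathbb{E}(Y)=\mu_0$. (ii) $\mathcal{X}_w$ is not calibrated: $\mathbb{P}\left[\mathbb{E}(Y\mid\mathcal{X}_w)\neq\mathcal{X}_w\right]>0$. (iii) The variance of $\mathcal{X}_w$ is too low: if $\mathcal{X}_w'':=\mathbb{E}(Y\mid\mathcal{X}_w)$ is the calibrated version of $\mathcal{X}_w$, then $\mathbb{E}(\mathcal{X}_w)=\mathbb{E}(\mathcal{X}_w'')=\mu_0$ but $\operatorname{Var}(\mathcal{X}_w)<\operatorname{Var}(\mathcal{X}_w'')$. (iv) $\mathcal{X}_w$ is not extremizing: $\operatorname{Var}(\mathcal{X}_w)<\max\left(\operatorname{Var}(X_1),\dots,\operatorname{Var}(X_N)\right)$. Thus $\operatorname{Var}(\mathcal{X}_w)<\operatorname{Var}(\mathcal{X}'')$. (v) $\mathcal{X}_w$ is inefficient: $\mathbb{P}(\mathcal{X}_w\neq\mathcal{X}'')>0$.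
   Context: All random variables are defined on the common probability space $(\Omega,\mathcal{F},\mathbb{P})$, and $\mathcal{L}^2$ denotes the random variables with finite second moment. A prediction $X_j$ of the outcome $Y$ is a real-valued random variable; it is calibrated if $\mathbb{E}(Y\mid X_j)=X_j$ a.s. (equivalently, $X_j=\mathbb{E}(Y\mid\mathcal{F}_j)$ a.s. for some sub-$\sigma$-field $\mathcal{F}_j\subseteq\mathcal{F}$). An arithmetic mean is $\mathcal{X}_w:=\sum_{j=1}^N w_jX_j$, where each weight $w_j\ge 0$ is fixed (a deterministic constant) and $\sum_{j=1}^N w_j=1$. It is non-trivial if there exists a pair $i\neq j$ such that $\mathbb{P}(X_i\neq X_j)>0$ and $w_i,w_j>0$. An aggregator $\mathcal{X}$ (a $\sigma(X_1,\dots,X_N)$-measurable random variable) is extremizing if $\operatorname{Var}[\mathbb{E}(Y\mid X_j,\ j\in\mathbf{v})]\le\operatorname{Var}(\mathcal{X})$ for all subsets $\mathbf{v}\subseteq\{1,\dots,N\}$, and efficient if it equals $\mathcal{X}''$ a.s. *)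

theory Defs
  imports "HOL-Probability.Probability"
begin

text \<open>Conditional expectation given a single real random variable \<open>Z\<close>, i.e. given the
  sigma-field of all preimages of Borel sets under \<open>Z\<close>.  As everywhere below, \<open>real_cond_exp\<close>
  picks one version of the (a.s. unique) conditional expectation.\<close>

definition cond_exp_on :: "'a measure \<Rightarrow> ('a \<Rightarrow> real) \<Rightarrow> ('a \<Rightarrow> real) \<Rightarrow> 'a \<Rightarrow> real" where
  "cond_exp_on M Y Z = real_cond_exp M (vimage_algebra (space M) Z borel) Y"

text \<open>The sigma-field generated by the family \<open>X j\<close>, \<open>j \<in> v\<close>.  It is generated explicitly on
  \<open>space M\<close>, so that it is the trivial sigma-field on \<open>space M\<close> for empty \<open>v\<close> (a supremum of
  \<open>vimage_algebra\<close>s would have empty space in that case).\<close>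

definition generated_field :: "'a measure \<Rightarrow> (nat \<Rightarrow> 'a \<Rightarrow> real) \<Rightarrow> nat set \<Rightarrow> 'a measure" where
  "generated_field M X v =
     sigma (space M) (\<Union>j\<in>v. {X j -` A \<inter> space M | A. A \<in> sets borel})"

definition cond_exp_family ::
    "'a measure \<Rightarrow> ('a \<Rightarrow> real) \<Rightarrow> (nat \<Rightarrow> 'a \<Rightarrow> real) \<Rightarrow> nat set \<Rightarrow> 'a \<Rightarrow> real" where
  "cond_exp_family M Y X v = real_cond_exp M (generated_field M X v) Y"

definition calibrated :: "'a measure \<Rightarrow> ('a \<Rightarrow> real) \<Rightarrow> ('a \<Rightarrow> real) \<Rightarrow> bool" where
  "calibrated M Y Z \<longleftrightarrow> (AE x in M. cond_exp_on M Y Z x = Z x)"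

definition arithmetic_mean :: "nat \<Rightarrow> (nat \<Rightarrow> real) \<Rightarrow> (nat \<Rightarrow> 'a \<Rightarrow> real) \<Rightarrow> 'a \<Rightarrow> real" where
  "arithmetic_mean N w X = (\<lambda>x. \<Sum>j=1..N. w j * X j x)"

definition non_trivial_weights ::
    "'a measure \<Rightarrow> nat \<Rightarrow> (nat \<Rightarrow> real) \<Rightarrow> (nat \<Rightarrow> 'a \<Rightarrow> real) \<Rightarrow> bool" where
  "non_trivial_weights M N w X \<longleftrightarrow>
     (\<exists>i\<in>{1..N}. \<exists>j\<in>{1..N}. i \<noteq> j \<and> measure M {x \<in> space M. X i x \<noteq> X j x} > 0
        \<and> w i > 0 \<and> w j > 0)"

text \<open>The next two notions are meant for aggregators \<open>Z\<close>, i.e. random variables that are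
  measurable with respect to \<open>generated_field M X {1..N}\<close>.  Measurability is deliberately not
  built into them, so that their negations cannot hold for lack of measurability.\<close>

definition extremizing ::
    "'a measure \<Rightarrow> ('a \<Rightarrow> real) \<Rightarrow> nat \<Rightarrow> (nat \<Rightarrow> 'a \<Rightarrow> real) \<Rightarrow> ('a \<Rightarrow> real) \<Rightarrow> bool" where
  "extremizing M Y N X Z \<longleftrightarrow>
     (\<forall>v \<subseteq> {1..N}. prob_space.variance M (cond_exp_family M Y X v) \<le> prob_space.variance M Z)"

definition efficient ::
    "'a measure \<Rightarrow> ('a \<Rightarrow> real) \<Rightarrow> nat \<Rightarrow> (nat \<Rightarrow> 'a \<Rightarrow> real) \<Rightarrow> ('a \<Rightarrow> real) \<Rightarrow> bool" where
  "efficient M Y N X Z \<longleftrightarrow> (AE x in M. Z x = cond_exp_family M Y X {1..N} x)"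

end

theory Submission
  imports Defs
begin

text \<open>For calibrated \<open>X\<^sub>j\<close> one has \<open>E(Y X\<^sub>j) = E(X\<^sub>j\<^sup>2)\<close>, so \<open>E(Y X\<^sub>w)\<close> is the weighted average of
  the \<open>E(X\<^sub>j\<^sup>2)\<close>, and strict convexity of the square makes this larger than \<open>E(X\<^sub>w\<^sup>2)\<close>.  If
  \<open>X\<^sub>w\<close> is measurable for a sub-sigma-field \<open>F\<close> and \<open>V = E(Y | F)\<close>, then
  \<open>E(V X\<^sub>w) = E(Y X\<^sub>w) > E(X\<^sub>w\<^sup>2)\<close>, and \<open>E((V - X\<^sub>w)\<^sup>2) \<ge> 0\<close> gives \<open>E(X\<^sub>w\<^sup>2) < E(V\<^sup>2)\<close>.
  Taking for \<open>F\<close> the field of \<open>X\<^sub>w\<close> and that of all the \<open>X\<^sub>j\<close> yields every strict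
  inequality of the theorem; each of them rules out almost sure equality of \<open>X\<^sub>w\<close> and \<open>V\<close>.\<close>

section \<open>Products of square integrable functions, and generated sigma-fields\<close>

lemma integrable_mult_square_integrable:
  fixes f g :: "'a \<Rightarrow> real"
  assumes [measurable]: "f \<in> borel_measurable M" "g \<in> borel_measurable M"
    and "integrable M (\<lambda>x. (f x)\<^sup>2)" "integrable M (\<lambda>x. (g x)\<^sup>2)"
  shows "integrable M (\<lambda>x. f x * g x)"
proof (rule Bochner_Integration.integrable_bound)
  show "integrable M (\<lambda>x. (f x)\<^sup>2 + (g x)\<^sup>2)"
    using assms by simp
  have "\<bar>a * b\<bar> \<le> a\<^sup>2 + b\<^sup>2" for a b :: real
  proof -
    have "2 * \<bar>a\<bar> * \<bar>b\<bar> \<le> a\<^sup>2 + b\<^sup>2"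
      using sum_squares_bound[of "\<bar>a\<bar>" "\<bar>b\<bar>"] by simp
    moreover have "0 \<le> \<bar>a\<bar> * \<bar>b\<bar>" by simp
    ultimately show ?thesis unfolding abs_mult by linarith
  qed
  then show "AE x in M. norm (f x * g x) \<le> norm ((f x)\<^sup>2 + (g x)\<^sup>2)"
    by simp
qed simp

lemma borel_measurable_arithmetic_mean:
  assumes "\<And>j. j \<in> {1..N} \<Longrightarrow> X j \<in> borel_measurable F"
  shows "arithmetic_mean N w X \<in> borel_measurable F"
  unfolding arithmetic_mean_def
  using assms by (intro borel_measurable_sum borel_measurable_times) auto

lemma subalgebra_vimage_algebra:
  assumes "Z \<in> measurable M N"
  shows "subalgebra M (vimage_algebra (space M) Z N)"
  unfolding subalgebra_def
  using assms measurable_space[OF assms]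
  by (auto simp: sets_vimage_algebra2 measurable_sets)

lemma subalgebra_generated_field:
  assumes "\<And>j. j \<in> v \<Longrightarrow> X j \<in> borel_measurable M"
  shows "subalgebra M (generated_field M X v)"
  unfolding subalgebra_def generated_field_def
  using assms by (auto intro!: sets.sigma_sets_subset simp: sets_measure_of_conv space_measure_of_conv measurable_sets)

lemma measurable_generated_field:
  assumes "j \<in> v"
  shows "X j \<in> borel_measurable (generated_field M X v)"
proof (rule measurableI)
  \<comment> \<open>\<open>sigma\<close> yields the generated sigma-field only if the generators lie
    in the power set of the space; otherwise it falls back to the trivial one.\<close>
  have *: "(\<Union>j\<in>v. {X j -` A \<inter> space M | A. A \<in> sets borel}) \<subseteq> Pow (space M)"
    by auto
  fix A :: "real set" assume "A \<in> sets borel"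
  then show "X j -` A \<inter> space (generated_field M X v) \<in> sets (generated_field M X v)"
    using assms *
    unfolding generated_field_def space_measure_of[OF *] sets_measure_of[OF *]
    by (intro sigma_sets.Basic) auto
qed simp

section \<open>Conditional expectation of a square integrable variable\<close>

context finite_measure_subalgebra
begin

context
  fixes Y :: "'a \<Rightarrow> real"
  assumes Y[measurable]: "Y \<in> borel_measurable M" and Y2: "integrable M (\<lambda>x. (Y x)\<^sup>2)"
begin

text \<open>Conditional Jensen inequality for the square, which is convex on the whole line.\<close>

lemma square_integrable_real_cond_exp: "integrable M (\<lambda>x. (real_cond_exp M F Y x)\<^sup>2)"
  by (rule integrable_convex_cond_exp[where I = UNIV and X = Y])
     (use Y2 square_integrable_imp_integrable[OF Y Y2] in
       \<open>auto simp: convex_power2\<close>)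

lemma integral_mult_real_cond_exp:
  assumes Z: "Z \<in> borel_measurable F" and Z2: "integrable M (\<lambda>x. (Z x)\<^sup>2)"
  shows "integrable M (\<lambda>x. Z x * real_cond_exp M F Y x)"
    and "(\<integral>x. Z x * real_cond_exp M F Y x \<partial>M) = (\<integral>x. Z x * Y x \<partial>M)"
  using real_cond_exp_intg[OF _ Z Y]
    integrable_mult_square_integrable[OF measurable_from_subalg[OF subalg Z] Y Z2 Y2]
  by auto

lemma integral_square_less_real_cond_exp:
  assumes Z: "Z \<in> borel_measurable F" and Z2: "integrable M (\<lambda>x. (Z x)\<^sup>2)"
    and less: "(\<integral>x. (Z x)\<^sup>2 \<partial>M) < (\<integral>x. Z x * Y x \<partial>M)"
  shows "(\<integral>x. (Z x)\<^sup>2 \<partial>M) < (\<integral>x. (real_cond_exp M F Y x)\<^sup>2 \<partial>M)"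
proof -
  let ?V = "real_cond_exp M F Y"
  note int = integral_mult_real_cond_exp(1)[OF Z Z2]
  have "0 \<le> (\<integral>x. (?V x - Z x)\<^sup>2 \<partial>M)"
    by simp
  also have "\<dots> = (\<integral>x. (?V x)\<^sup>2 + (Z x)\<^sup>2 - 2 * (Z x * ?V x) \<partial>M)"
    by (simp add: power2_diff algebra_simps)
  also have "\<dots> = (\<integral>x. (?V x)\<^sup>2 \<partial>M) + (\<integral>x. (Z x)\<^sup>2 \<partial>M) - 2 * (\<integral>x. Z x * ?V x \<partial>M)"
    using int Z2 square_integrable_real_cond_exp by simp
  finally show ?thesis
    using less integral_mult_real_cond_exp(2)[OF Z Z2] by linarith
qed

end

end

section \<open>Variances and the moments of calibrated predictions\<close>

context prob_space
begin

lemma finite_measure_subalgebraI: "subalgebra M F \<Longrightarrow> finite_measure_subalgebra M F"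
  by (intro finite_measure_subalgebra.intro finite_measure_axioms)
     (simp add: finite_measure_subalgebra_axioms_def)

lemma prob_neq_pos_iff:
  fixes f g :: "'a \<Rightarrow> real"
  assumes [measurable]: "f \<in> borel_measurable M" "g \<in> borel_measurable M"
  shows "prob {x \<in> space M. f x \<noteq> g x} > 0 \<longleftrightarrow> \<not> (AE x in M. f x = g x)"
proof -
  have "prob {x \<in> space M. f x \<noteq> g x} = 0 \<longleftrightarrow> (AE x in M. \<not> f x \<noteq> g x)"
    by (rule prob_Collect_eq_0) simp
  then show ?thesis
    by (simp add: zero_less_measure_iff)
qed

text \<open>With a common mean, variance and second moment differ by the same constant for both
  variables. This turns inner product estimates into statements on variances.\<close>

lemma variance_less_iff:
  fixes f g :: "'a \<Rightarrow> real"
  assumes "f \<in> borel_measurable M" "g \<in> borel_measurable M"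
    and "integrable M (\<lambda>x. (f x)\<^sup>2)" "integrable M (\<lambda>x. (g x)\<^sup>2)"
    and "expectation f = expectation g"
  shows "variance f < variance g \<longleftrightarrow> expectation (\<lambda>x. (f x)\<^sup>2) < expectation (\<lambda>x. (g x)\<^sup>2)"
proof -
  have "variance h = expectation (\<lambda>x. (h x)\<^sup>2) - (expectation h)\<^sup>2"
    if "h \<in> borel_measurable M" "integrable M (\<lambda>x. (h x)\<^sup>2)" for h :: "'a \<Rightarrow> real"
    using that by (simp add: variance_eq square_integrable_imp_integrable)
  from this[of f] this[of g] show ?thesis
    using assms by simp
qed

text \<open>A calibrated \<open>Z\<close> is almost surely a conditional expectation of
  \<open>Y\<close>, so it inherits square integrability from \<open>Y\<close> by Jensen and the mean
  of \<open>Y\<close> by the tower property. As \<open>Z\<close> is measurable for its own field, it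
  can be pulled out of the conditional expectation, which gives the mixed moment.\<close>

lemma calibrated_moments:
  assumes Y[measurable]: "Y \<in> borel_measurable M" and Y2: "integrable M (\<lambda>x. (Y x)\<^sup>2)"
    and Z[measurable]: "Z \<in> borel_measurable M" and cal: "calibrated M Y Z"
  shows "integrable M (\<lambda>x. (Z x)\<^sup>2)"
    and "expectation Z = expectation Y"
    and "expectation (\<lambda>x. Z x * Y x) = expectation (\<lambda>x. (Z x)\<^sup>2)"
proof -
  let ?F = "vimage_algebra (space M) Z borel"
  interpret F: finite_measure_subalgebra M ?F
    by (intro finite_measure_subalgebraI subalgebra_vimage_algebra Z)
  have ae: "AE x in M. real_cond_exp M ?F Y x = Z x"
    using cal by (simp add: calibrated_def cond_exp_on_def)
  have [measurable]: "real_cond_exp M ?F Y \<in> borel_measurable M"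
    by (rule borel_measurable_cond_exp2)
  have "integrable M (\<lambda>x. (real_cond_exp M ?F Y x)\<^sup>2) \<longleftrightarrow> integrable M (\<lambda>x. (Z x)\<^sup>2)"
    using ae by (intro integrable_cong_AE) auto
  then show Z2: "integrable M (\<lambda>x. (Z x)\<^sup>2)"
    using F.square_integrable_real_cond_exp[OF Y Y2] by simp
  have "expectation (real_cond_exp M ?F Y) = expectation Z"
    using ae by (intro integral_cong_AE) auto
  then show "expectation Z = expectation Y"
    using F.real_cond_exp_int(2) square_integrable_imp_integrable[OF Y Y2] by simp
  have "Z \<in> borel_measurable ?F"
    by (rule measurable_vimage_algebra1) simp
  then have "expectation (\<lambda>x. Z x * Y x) = expectation (\<lambda>x. Z x * real_cond_exp M ?F Y x)"
    using F.integral_mult_real_cond_exp(2)[OF Y Y2 _ Z2] by simp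
  also have "\<dots> = expectation (\<lambda>x. (Z x)\<^sup>2)"
    using ae by (intro integral_cong_AE) (auto simp: power2_eq_square)
  finally show "expectation (\<lambda>x. Z x * Y x) = expectation (\<lambda>x. (Z x)\<^sup>2)" .
qed

section \<open>Strict convexity of the square for weighted means\<close>

context
  fixes N :: nat and w :: "nat \<Rightarrow> real" and X :: "nat \<Rightarrow> 'a \<Rightarrow> real"
  assumes X: "\<And>j. j \<in> {1..N} \<Longrightarrow> X j \<in> borel_measurable M"
    and X2: "\<And>j. j \<in> {1..N} \<Longrightarrow> integrable M (\<lambda>x. (X j x)\<^sup>2)"
    and w_nonneg: "\<And>j. j \<in> {1..N} \<Longrightarrow> w j \<ge> 0"
    and w_sum: "(\<Sum>j=1..N. w j) = 1"
begin

text \<open>For each fixed \<open>x\<close>, the weights form a probability distribution on the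
  indices, and this is the variance formula for it. It writes the Jensen gap of the square as a sum
  of terms that are nonnegative for nonnegative weights.\<close>

lemma weighted_square_deviation:
  "(\<Sum>j=1..N. w j * (X j x - arithmetic_mean N w X x)\<^sup>2) =
     (\<Sum>j=1..N. w j * (X j x)\<^sup>2) - (arithmetic_mean N w X x)\<^sup>2"
proof -
  define m where "m = arithmetic_mean N w X x"
  have m: "m = (\<Sum>j=1..N. w j * X j x)"
    by (simp add: m_def arithmetic_mean_def)
  have "(\<Sum>j=1..N. w j * (X j x - m)\<^sup>2) =
      (\<Sum>j=1..N. w j * (X j x)\<^sup>2 - 2 * m * (w j * X j x) + m\<^sup>2 * w j)"
    by (intro sum.cong) (auto simp: power2_eq_square algebra_simps)
  also have "\<dots> = (\<Sum>j=1..N. w j * (X j x)\<^sup>2) - 2 * m * m + m\<^sup>2 * 1"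
    unfolding sum.distrib sum_subtractf sum_distrib_left[symmetric] m[symmetric] w_sum ..
  finally show ?thesis
    by (simp add: m_def power2_eq_square)
qed

lemma square_integrable_arithmetic_mean:
  "integrable M (\<lambda>x. (arithmetic_mean N w X x)\<^sup>2)"
proof (rule Bochner_Integration.integrable_bound)
  show "integrable M (\<lambda>x. \<Sum>j=1..N. w j * (X j x)\<^sup>2)"
    using X2 by (intro Bochner_Integration.integrable_sum integrable_mult_right) auto
  have [measurable]: "arithmetic_mean N w X \<in> borel_measurable M"
    by (rule borel_measurable_arithmetic_mean[OF X])
  show "(\<lambda>x. (arithmetic_mean N w X x)\<^sup>2) \<in> borel_measurable M"
    by simp
  have "0 \<le> (\<Sum>j=1..N. w j * (X j x - arithmetic_mean N w X x)\<^sup>2)" for x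
    using w_nonneg by (intro sum_nonneg) auto
  then have "(arithmetic_mean N w X x)\<^sup>2 \<le> (\<Sum>j=1..N. w j * (X j x)\<^sup>2)" for x
    unfolding weighted_square_deviation by simp
  then show "AE x in M. norm ((arithmetic_mean N w X x)\<^sup>2) \<le> norm (\<Sum>j=1..N. w j * (X j x)\<^sup>2)"
    by (intro AE_I2) (simp add: order_trans[OF _ abs_ge_self])
qed

text \<open>The gap between the two sides is the expectation of the weighted square deviation
  \<open>?D\<close>. If it were not positive, \<open>?D\<close> would vanish almost surely, and then
  all predictions of positive weight would coincide with the mean, hence with each other, against
  non-triviality.\<close>

lemma expectation_square_arithmetic_mean_less:
  assumes "non_trivial_weights M N w X"
  shows "expectation (\<lambda>x. (arithmetic_mean N w X x)\<^sup>2) <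
    (\<Sum>j=1..N. w j * expectation (\<lambda>x. (X j x)\<^sup>2))"
proof (rule ccontr)
  let ?m = "arithmetic_mean N w X"
  let ?D = "\<lambda>x. \<Sum>j=1..N. w j * (X j x - ?m x)\<^sup>2"
  assume not_less: "\<not> ?thesis"
  have int: "integrable M (\<lambda>x. \<Sum>j=1..N. w j * (X j x)\<^sup>2)"
    using X2 by (intro Bochner_Integration.integrable_sum integrable_mult_right) auto
  have D_int: "integrable M ?D"
    unfolding weighted_square_deviation
    by (intro Bochner_Integration.integrable_diff int square_integrable_arithmetic_mean)
  have D_nonneg: "0 \<le> ?D x" for x
    using w_nonneg by (intro sum_nonneg) auto
  have "expectation ?D =
      expectation (\<lambda>x. \<Sum>j=1..N. w j * (X j x)\<^sup>2) - expectation (\<lambda>x. (?m x)\<^sup>2)"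
    unfolding weighted_square_deviation
    by (intro Bochner_Integration.integral_diff int square_integrable_arithmetic_mean)
  also have "expectation (\<lambda>x. \<Sum>j=1..N. w j * (X j x)\<^sup>2) =
      (\<Sum>j=1..N. w j * expectation (\<lambda>x. (X j x)\<^sup>2))"
    using X2 by (subst Bochner_Integration.integral_sum) auto
  finally have "expectation ?D \<le> 0"
    using not_less by simp
  then have "expectation ?D = 0"
    using D_nonneg by (intro antisym) (auto intro!: integral_nonneg)
  then have D0: "AE x in M. ?D x = 0"
    using integral_nonneg_eq_0_iff_AE[OF D_int] D_nonneg by simp
  obtain i j where ij: "i \<in> {1..N}" "j \<in> {1..N}" "w i > 0" "w j > 0"
    and neq: "prob {x \<in> space M. X i x \<noteq> X j x} > 0"
    using assms by (auto simp: non_trivial_weights_def)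
  have eq: "X k x = ?m x" if "?D x = 0" "k \<in> {1..N}" "w k > 0" for k x
  proof -
    have "\<forall>j\<in>{1..N}. w j * (X j x - ?m x)\<^sup>2 = 0"
      using that(1) w_nonneg by (subst (asm) sum_nonneg_eq_0_iff) auto
    then have "w k * (X k x - ?m x)\<^sup>2 = 0"
      using that(2) by blast
    then show ?thesis
      using that by simp
  qed
  have "AE x in M. X i x = X j x"
    using D0 by eventually_elim (metis eq ij)
  then show False
    using neq prob_neq_pos_iff X ij by blast
qed

end

end

section \<open>The five properties of the mean\<close>

theorem theorem3p2:
  fixes M :: "'a measure" and Y :: "'a \<Rightarrow> real" and X :: "nat \<Rightarrow> 'a \<Rightarrow> real"
    and N :: nat and w :: "nat \<Rightarrow> real" and \<mu>\<^sub>0 :: real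
    and Xw Xw'' X'' :: "'a \<Rightarrow> real"
  assumes "prob_space M"
    and "Y \<in> borel_measurable M"
    and "integrable M (\<lambda>x. (Y x)\<^sup>2)"
    and "\<mu>\<^sub>0 = prob_space.expectation M Y"
    and "\<And>j. j \<in> {1..N} \<Longrightarrow> X j \<in> borel_measurable M"
    and "\<And>j. j \<in> {1..N} \<Longrightarrow> calibrated M Y (X j)"
    and "X'' = cond_exp_family M Y X {1..N}"
    and "\<And>j. j \<in> {1..N} \<Longrightarrow> w j \<ge> 0"
    and "(\<Sum>j=1..N. w j) = 1"
    and "Xw = arithmetic_mean N w X"
    and "non_trivial_weights M N w X"
    and "Xw'' = cond_exp_on M Y Xw"
  shows
    "(prob_space.expectation M Xw = prob_space.expectation M Y \<and> prob_space.expectation M Y = \<mu>\<^sub>0)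
     \<and> (\<not> calibrated M Y Xw \<and> measure M {x \<in> space M. cond_exp_on M Y Xw x \<noteq> Xw x} > 0)
     \<and> (prob_space.expectation M Xw = prob_space.expectation M Xw''
          \<and> prob_space.expectation M Xw'' = \<mu>\<^sub>0
          \<and> prob_space.variance M Xw < prob_space.variance M Xw'')
     \<and> (\<not> extremizing M Y N X Xw
          \<and> prob_space.variance M Xw < (MAX j\<in>{1..N}. prob_space.variance M (X j))
          \<and> prob_space.variance M Xw < prob_space.variance M X'')
     \<and> (\<not> efficient M Y N X Xw \<and> measure M {x \<in> space M. Xw x \<noteq> X'' x} > 0)"
proof -
  interpret prob_space M by fact
  note Y = assms(2) and Y2 = assms(3) and X = assms(5) and cal = assms(6) and w = assms(8,9)
  have [measurable]: "Y \<in> borel_measurable M" by (fact Y)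
  note X_mom = calibrated_moments[OF Y Y2 X cal]
  have Xw[measurable]: "Xw \<in> borel_measurable M"
    unfolding assms(10) by (rule borel_measurable_arithmetic_mean[OF X])
  have Xw2: "integrable M (\<lambda>x. (Xw x)\<^sup>2)"
    unfolding assms(10) by (rule square_integrable_arithmetic_mean[OF X X_mom(1) w])
  have "expectation Xw = (\<Sum>j=1..N. w j * expectation (X j))"
    unfolding assms(10) arithmetic_mean_def
    using square_integrable_imp_integrable[OF X X_mom(1)]
    by (subst Bochner_Integration.integral_sum) auto
  also have "\<dots> = (\<Sum>j=1..N. w j) * expectation Y"
    unfolding sum_distrib_right using X_mom(2) by (intro sum.cong) auto
  finally have Xw_exp: "expectation Xw = expectation Y"
    using w by simp
  have sq_less: "expectation (\<lambda>x. (Xw x)\<^sup>2) < (\<Sum>j=1..N. w j * expectation (\<lambda>x. (X j x)\<^sup>2))"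
    unfolding assms(10)
    by (rule expectation_square_arithmetic_mean_less[OF X X_mom(1) w assms(11)])
  have "expectation (\<lambda>x. Xw x * Y x) = expectation (\<lambda>x. \<Sum>j=1..N. w j * (X j x * Y x))"
    unfolding assms(10) arithmetic_mean_def by (simp add: sum_distrib_right mult.assoc)
  also have "\<dots> = (\<Sum>j=1..N. w j * expectation (\<lambda>x. X j x * Y x))"
    using integrable_mult_square_integrable[OF X Y X_mom(1) Y2]
    by (subst Bochner_Integration.integral_sum) auto
  also have "\<dots> = (\<Sum>j=1..N. w j * expectation (\<lambda>x. (X j x)\<^sup>2))"
    using X_mom(3) by (intro sum.cong) auto
  finally have less: "expectation (\<lambda>x. (Xw x)\<^sup>2) < expectation (\<lambda>x. Xw x * Y x)"
    using sq_less by simp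

  \<comment> \<open>Stated for an arbitrary \<open>F\<close>, to be used for the field of
    \<open>Xw\<close> in (ii) and (iii) and for that of all predictions in (iv) and (v).\<close>
  have cond_exp: "expectation (real_cond_exp M F Y) = expectation Y"
      "variance Xw < variance (real_cond_exp M F Y)"
      "prob {x \<in> space M. Xw x \<noteq> real_cond_exp M F Y x} > 0"
    if F: "subalgebra M F" and XwF: "Xw \<in> borel_measurable F" for F
  proof -
    interpret F: finite_measure_subalgebra M F
      by (rule finite_measure_subalgebraI[OF F])
    have V[measurable]: "real_cond_exp M F Y \<in> borel_measurable M"
      by (rule borel_measurable_cond_exp2)
    show exp: "expectation (real_cond_exp M F Y) = expectation Y"
      using F.real_cond_exp_int(2) square_integrable_imp_integrable[OF Y Y2] by simp
    show var: "variance Xw < variance (real_cond_exp M F Y)"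
      using F.integral_square_less_real_cond_exp[OF Y Y2 XwF Xw2 less]
        variance_less_iff[OF Xw V Xw2 F.square_integrable_real_cond_exp[OF Y Y2]] exp Xw_exp
      by simp
    \<comment> \<open>Variance depends only on the almost sure class, so the strict inequality
      \<open>var\<close> excludes almost sure equality.\<close>
    have "variance Xw = variance (real_cond_exp M F Y)"
      if "AE x in M. Xw x = real_cond_exp M F Y x"
      unfolding exp Xw_exp using that by (intro integral_cong_AE) auto
    then show "prob {x \<in> space M. Xw x \<noteq> real_cond_exp M F Y x} > 0"
      using var prob_neq_pos_iff[OF Xw V] by auto
  qed

  have "Xw \<in> borel_measurable (vimage_algebra (space M) Xw borel)"
    by (rule measurable_vimage_algebra1) simp
  note on = cond_exp[OF subalgebra_vimage_algebra[OF Xw] this, folded cond_exp_on_def]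
  have "Xw \<in> borel_measurable (generated_field M X {1..N})"
    unfolding assms(10) by (intro borel_measurable_arithmetic_mean measurable_generated_field)
  note family = cond_exp[OF subalgebra_generated_field this, of, folded cond_exp_family_def, OF X]
  have on_meas: "cond_exp_on M Y Xw \<in> borel_measurable M"
    unfolding cond_exp_on_def by (rule borel_measurable_cond_exp2)
  have family_meas: "cond_exp_family M Y X {1..N} \<in> borel_measurable M"
    unfolding cond_exp_family_def by (rule borel_measurable_cond_exp2)
  have not_cal: "prob {x \<in> space M. cond_exp_on M Y Xw x \<noteq> Xw x} > 0"
    using on(3) by (simp add: eq_commute)

  \<comment> \<open>Otherwise no variance of a prediction exceeds that of \<open>Xw\<close>. All
    means agree, so the same holds for second moments, and averaging them with the weights
    contradicts \<open>sq_less\<close>.\<close>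
  have var_less: "variance Xw < (MAX j\<in>{1..N}. variance (X j))"
  proof (rule ccontr)
    assume "\<not> ?thesis"
    moreover have "variance (X j) \<le> (MAX j\<in>{1..N}. variance (X j))" if "j \<in> {1..N}" for j
      using that by (intro Max_ge) auto
    ultimately have "variance (X j) \<le> variance Xw" if "j \<in> {1..N}" for j
      using that by (meson not_less order_trans)
    then have "expectation (\<lambda>x. (X j x)\<^sup>2) \<le> expectation (\<lambda>x. (Xw x)\<^sup>2)" if "j \<in> {1..N}" for j
      using variance_less_iff[OF Xw X Xw2 X_mom(1)] X_mom(2) Xw_exp that
      by (metis not_less)
    then have "(\<Sum>j=1..N. w j * expectation (\<lambda>x. (X j x)\<^sup>2))
        \<le> (\<Sum>j=1..N. w j * expectation (\<lambda>x. (Xw x)\<^sup>2))"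
      using w by (intro sum_mono mult_left_mono) auto
    then show False
      using sq_less w by (simp add: sum_distrib_right[symmetric])
  qed

  have "\<not> calibrated M Y Xw"
    using not_cal prob_neq_pos_iff[OF on_meas Xw] by (simp add: calibrated_def)
  moreover have "\<not> efficient M Y N X Xw"
    using family(3) prob_neq_pos_iff[OF Xw family_meas] by (simp add: efficient_def)
  \<comment> \<open>The violating subset is the full index set \<open>{1..N}\<close>.\<close>
  moreover have "\<not> extremizing M Y N X Xw"
    using family(2) by (auto simp: extremizing_def not_le)
  ultimately show ?thesis
    unfolding assms(7,12) assms(4)
    using Xw_exp on(1,2) not_cal var_less family(2,3) by simp
qed

end
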